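(* Let $\{x^k\}$ be an infinite sequence generated by Algorithm iBDCA (described in the context), with associated $w^k,y^k,d^k,\lambda_k$. Then, for every $k\ge0$, $$\Phi_\rho(x^{k+1})\le\Phi_\rho(w^k)-\sigma\lambda_k^2\|d^k\|^2\le\Phi_\rho(x^k)-\sigma\lambda_k^2\|d^k\|^2.$$ In addition, $$\Phi_\rho(w^{k+1})\le\Phi_\rho(x^{k+1})\le\Phi_\rho(y^k)\le\Phi_\rho(w^k)$$ and $$\Phi_\rho(w^{k+1})\le\Phi_\rho(w^k)-\sigma\lambda_k^2\|d^k\|^2.$$ Consequently, both $\{\Phi_\rho(x^k)\}$ and $\{\Phi_\rho(w^k)\}$ are nonincreasing, and $$\sum_{k=0}^\infty\lambda_k^2\|d^k\|^2<+\infty,\qquad\sum_{k=0}^\infty\|d^k\|^2<+\infty.$$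
   Context: Model. Let $n,T\in\mathbb N=\{1,2,\dots\}$. Let $X:=\{z\in\mathbb R^n:\sum_{i=1}^n z_i=1,\ z_i\ge 0,\ i=1,\dots,n\}$ and $\mathcal X:=X^T\subset(\mathbb R^n)^T\cong\mathbb R^{nT}$; elements are written $x=(x^1,\dots,x^T)$ with blocks $x^t\in\mathbb R^n$, and $\|\cdot\|$ is the Euclidean norm. Fix $w_{\mathrm{prev}}\in X$. For each $t=1,\dots,T$ let $S_t\in\mathbb N$ and let $\xi^t$ be a discrete random vector taking values $\xi^t_j\in\mathbb R^n$ with probabilities $p^t_j>0$, $j=1,\dots,S_t$, $\sum_{j=1}^{S_t}p^t_j=1$; put $\mu^t:=\sum_{j=1}^{S_t}p_j^t\xi_j^t$ and $L_j^t(z):=-(\xi_j^t)^\top z$. Fix $\alpha\in(0,1)$, $\lambda_1>0$, $\lambda_2>0$, $c_i\ge 0$ ($i=1,\dots,n$), and $\tau\in\mathbb R$. Let $(a)_+:=\max\{a,0\}$. For a real random variable $L$, $\operatorname{VaR}_\alpha(L):=\inf\{u\in\mathbb R:\mathbb P(L\le u)\ge\alpha\}$. $f(x):=-\sum_{t=1}^T(\mu^t)^\top x^t+\lambda_1\Big[\sum_{i=1}^n c_i|x_i^1-(w_{\mathrm{prev}})_i|+\sum_{t=2}^T\sum_{i=1}^n c_i|x_i^t-x_i^{t-1}|\Big]+\lambda_2\sum_{t=1}^T\|x^t\|^2$; $R(x):=\sum_{t=1}^T\big(\operatorname{VaR}_\alpha(-(\xi^t)^\top x^t)-\tau\big)_+$;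 for $\rho>0$, $\Phi_\rho:=f+\rho R$. DC decomposition. For $\beta\in(0,1)$ let $\psi_{\beta,t}(z):=\min_{u\in\mathbb R}\{u+\frac1{1-\beta}\sum_{j=1}^{S_t}p_j^t(L_j^t(z)-u)_+\}$ (the CVaR at level $\beta$ of $-(\xi^t)^\top z$). Let $\bar\varepsilon_t:=\alpha-\max\{\sum_{j\in J}p_j^t: J\subseteq\{1,\dots,S_t\},\ \sum_{j\in J}p_j^t<\alpha\}$ (empty sum $=0$), fix $0<\gamma<\min_t\bar\varepsilon_t$, and set $A_\gamma:=\frac{1-\alpha+\gamma}{\gamma}$, $B_\gamma:=\frac{1-\alpha}{\gamma}$. Then $\operatorname{VaR}_\alpha(-(\xi^t)^\top z)=A_\gamma\psi_{\alpha-\gamma,t}(z)-B_\gamma\psi_{\alpha,t}(z)$ and $\Phi_\rho=G_\rho-H_\rho$ with $G_\rho(x):=f(x)+\rho\sum_{t=1}^T\max\{A_\gamma\psi_{\alpha-\gamma,t}(x^t)-\tau,\ B_\gamma\psi_{\alpha,t}(x^t)\}$, $H_\rho(x):=\rho B_\gamma\sum_{t=1}^T\psi_{\alpha,t}(x^t)$. For fixed $\nu>0$: $\widehat G_\rho:=G_\rho+\frac\nu2\|\cdot\|^2$, $\widehat H_\rho:=H_\rho+\frac\nu2\|\cdot\|^2$. For convex functions $\partial$ is the convex subdifferential. Algorithm iBDCA. Input: $\rho>0$, $x^{-1}=x^0\in\mathcal X$, $\theta\in[0,1)$, $\nu>0$, $\sigma\in(0,\lambda_2+\nu)$, $\eta\in(0,1)$,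 $\bar\lambda>1$, $\varepsilon_{\mathrm{tol}}\ge0$. Here superscript $k$ indexes iterates in $\mathcal X$ and $w^{k,t}$ is the $t$-th block of $w^k$; $\Pi_{\mathcal X}$ is Euclidean projection onto $\mathcal X$. For $k=0,1,2,\dots$: 1. $w^k=\Pi_{\mathcal X}(x^k+\theta(x^k-x^{k-1}))$; if $\Phi_\rho(w^k)>\Phi_\rho(x^k)$, reset $w^k=x^k$. 2. For each $t$ compute $g_{\alpha,t}(w^{k,t})=-\frac{1}{1-\alpha}\sum_{j}p_j^t\vartheta_j\xi_j^t\in\partial\psi_{\alpha,t}(w^{k,t})$, where, for a minimizer $u^*$ in the definition of $\psi_{\alpha,t}(w^{k,t})$, $\vartheta_j=1$ if $L_j^t(w^{k,t})>u^*$, $\vartheta_j\in[0,1]$ if $L_j^t(w^{k,t})=u^*$, $\vartheta_j=0$ if $L_j^t(w^{k,t})<u^*$, and $\sum_jp_j^t\vartheta_j=1-\alpha$. Set $s^k=\rho B_\gamma(g_{\alpha,1}(w^{k,1}),\dots,g_{\alpha,T}(w^{k,T}))\in\partial H_\rho(w^k)$ and $u^k=s^k+\nu w^k\in\partial\widehat H_\rho(w^k)$. 3. $y^k=\operatorname*{arg\,min}_{x\in\mathcal X}\{\widehat G_\rho(x)-\langle u^k,x\rangle\}$ (unique solution); $d^k=y^k-w^k$. 4. If $\|d^k\|=0$, return $w^k$. If $\varepsilon_{\mathrm{tol}}>0$ and $\|d^k\|\le\varepsilon_{\mathrm{tol}}\max\{1,\|w^k\|\}$, return $w^k$. 5. (Line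 search) $\lambda_k^{\max}=\max\{\lambda\ge1:w^k+\lambda d^k\in\mathcal X\}$; $\lambda_k=\min\{\bar\lambda,\lambda_k^{\max}\}$. While $\lambda_k>1$ and $\Phi_\rho(w^k+\lambda_kd^k)>\min\{\Phi_\rho(y^k),\ \Phi_\rho(w^k)-\sigma\lambda_k^2\|d^k\|^2\}$, set $\lambda_k=\max\{1,\eta\lambda_k\}$. 6. $x^{k+1}=w^k+\lambda_kd^k$. "Infinite sequence generated" means the algorithm never returns. *)

theory Defs
  imports "HOL-Probability.Probability" "HOL-Library.While_Combinator"
begin

text \<open>
  A decision \<open>x = (x\<^sup>1, \<dots>, x\<^sup>T)\<close> is an element of \<open>(real ^ 'n) ^ 't\<close>: \<open>CARD('n)\<close> is the number of
  assets and \<open>'t\<close> is a finite linearly ordered type standing for the periods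
  \<open>1 < \<dots> < T\<close>, \<open>T = CARD('t)\<close>. The norm of \<open>(real ^ 'n) ^ 't\<close> is the Euclidean norm of
  \<open>nT\<close>-dimensional space.
\<close>

type_synonym ('n, 't) decision = "((real, 'n) vec, 't) vec"

definition first_period :: "'t::{finite,linorder}" where
  "first_period = Min UNIV"

text \<open>Only meaningful for \<open>t \<noteq> first_period\<close>.\<close>
definition prev_period :: "'t::{finite,linorder} \<Rightarrow> 't" where
  "prev_period t = Max {s. s < t}"

record ('w, 'n, 't) model =
  sp   :: "'w measure"  \<comment> \<open>underlying probability space\<close>
  rv   :: "'t \<Rightarrow> 'w \<Rightarrow> (real, 'n::finite) vec"  \<comment> \<open>the random vectors \<open>\<xi>\<^sup>t\<close>\<close>
  nsc  :: "'t \<Rightarrow> nat"  \<comment> \<open>\<open>S\<^sub>t\<close>\<close>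
  scen :: "'t \<Rightarrow> nat \<Rightarrow> (real, 'n) vec"  \<comment> \<open>the values \<open>\<xi>\<^sup>t\<^sub>j\<close>, \<open>1 \<le> j \<le> S\<^sub>t\<close>\<close>
  pr   :: "'t \<Rightarrow> nat \<Rightarrow> real"  \<comment> \<open>\<open>p\<^sup>t\<^sub>j\<close>\<close>
  wprev :: "(real, 'n) vec"
  alpha   :: real
  gam   :: real
  lam1   :: real
  lam2   :: real
  cost :: "(real, 'n) vec"
  tau   :: real
  rho   :: real

definition unit_simplex :: "(real ^ 'n::finite) set" where
  "unit_simplex = {z. (\<Sum>i\<in>UNIV. z $ i) = 1 \<and> (\<forall>i. 0 \<le> z $ i)}"

definition feasible :: "('n::finite, 't::finite) decision set" where
  "feasible = {x. \<forall>t. x $ t \<in> unit_simplex}"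

definition pos_part :: "real \<Rightarrow> real" where
  "pos_part a = max a 0"

definition VaR :: "'w measure \<Rightarrow> real \<Rightarrow> ('w \<Rightarrow> real) \<Rightarrow> real" where
  "VaR M a L = Inf {u. a \<le> measure M {\<omega> \<in> space M. L \<omega> \<le> u}}"

definition eps_bar :: "('w, 'n::finite, 't) model \<Rightarrow> 't \<Rightarrow> real" where
  "eps_bar P t = alpha P - Max {sum (pr P t) J | J. J \<subseteq> {1..nsc P t} \<and> sum (pr P t) J < alpha P}"

text \<open>
  The values \<open>\<xi>\<^sup>t\<^sub>j\<close>, \<open>j = 1, \<dots>, S\<^sub>t\<close>, need not be pairwise distinct, so the probability of a
  point is the sum of the \<open>p\<^sup>t\<^sub>j\<close> over all indices \<open>j\<close> yielding that point.
\<close>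
definition valid_model :: "('w, 'n::finite, 't::{finite,linorder}) model \<Rightarrow> bool" where
  "valid_model P \<longleftrightarrow>
     wprev P \<in> unit_simplex \<and>
     (\<forall>t. 1 \<le> nsc P t \<and> (\<forall>j\<in>{1..nsc P t}. 0 < pr P t j) \<and> (\<Sum>j=1..nsc P t. pr P t j) = 1) \<and>
     prob_space (sp P) \<and>
     (\<forall>t. rv P t \<in> borel_measurable (sp P) \<and>
        (\<forall>v. measure (sp P) {\<omega> \<in> space (sp P). rv P t \<omega> = v}
              = (\<Sum>j\<in>{j \<in> {1..nsc P t}. scen P t j = v}. pr P t j))) \<and>
     0 < alpha P \<and> alpha P < 1 \<and> 0 < lam1 P \<and> 0 < lam2 P \<and> (\<forall>i. 0 \<le> cost P $ i) \<and>
     0 < gam P \<and> gam P < Min (range (eps_bar P)) \<and>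
     0 < rho P"

definition mean :: "('w, 'n::finite, 't) model \<Rightarrow> 't \<Rightarrow> real ^ 'n" where
  "mean P t = (\<Sum>j=1..nsc P t. pr P t j *\<^sub>R scen P t j)"

definition loss :: "('w, 'n::finite, 't) model \<Rightarrow> 't \<Rightarrow> nat \<Rightarrow> real ^ 'n \<Rightarrow> real" where
  "loss P t j z = - (scen P t j \<bullet> z)"

definition obj :: "('w, 'n::finite, 't::{finite,linorder}) model \<Rightarrow> ('n, 't) decision \<Rightarrow> real" where
  "obj P x =
     - (\<Sum>t\<in>UNIV. mean P t \<bullet> x $ t)
     + lam1 P * ((\<Sum>i\<in>UNIV. cost P $ i * \<bar>x $ first_period $ i - wprev P $ i\<bar>)
        + (\<Sum>t\<in>UNIV - {first_period}. \<Sum>i\<in>UNIV. cost P $ i * \<bar>x $ t $ i - x $ prev_period t $ i\<bar>))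
     + lam2 P * (\<Sum>t\<in>UNIV. (norm (x $ t))\<^sup>2)"

definition var_penalty :: "('w, 'n::finite, 't::finite) model \<Rightarrow> ('n, 't) decision \<Rightarrow> real" where
  "var_penalty P x =
     (\<Sum>t\<in>UNIV. pos_part (VaR (sp P) (alpha P) (\<lambda>\<omega>. - (rv P t \<omega> \<bullet> x $ t)) - tau P))"

definition \<Phi>\<^sub>\<rho> :: "('w, 'n::finite, 't::{finite,linorder}) model \<Rightarrow> ('n, 't) decision \<Rightarrow> real" where
  "\<Phi>\<^sub>\<rho> P x = obj P x + rho P * var_penalty P x"

definition cvar_fun :: "('w, 'n::finite, 't) model \<Rightarrow> real \<Rightarrow> 't \<Rightarrow> real ^ 'n \<Rightarrow> real \<Rightarrow> real" where
  "cvar_fun P b t z u = u + 1 / (1 - b) * (\<Sum>j=1..nsc P t. pr P t j * pos_part (loss P t j z - u))"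

text \<open>For \<open>0 < b < 1\<close> in a valid model, the infimum is attained.\<close>
definition \<psi> :: "('w, 'n::finite, 't) model \<Rightarrow> real \<Rightarrow> 't \<Rightarrow> real ^ 'n \<Rightarrow> real" where
  "\<psi> P b t z = (INF u. cvar_fun P b t z u)"

definition A\<^sub>\<gamma> :: "('w, 'n::finite, 't) model \<Rightarrow> real" where
  "A\<^sub>\<gamma> P = (1 - alpha P + gam P) / gam P"

definition B\<^sub>\<gamma> :: "('w, 'n::finite, 't) model \<Rightarrow> real" where
  "B\<^sub>\<gamma> P = (1 - alpha P) / gam P"

definition G\<^sub>\<rho> :: "('w, 'n::finite, 't::{finite,linorder}) model \<Rightarrow> ('n, 't) decision \<Rightarrow> real" where
  "G\<^sub>\<rho> P x = obj P x + rho P * (\<Sum>t\<in>UNIV.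
     max (A\<^sub>\<gamma> P * \<psi> P (alpha P - gam P) t (x $ t) - tau P) (B\<^sub>\<gamma> P * \<psi> P (alpha P) t (x $ t)))"

record alg_input =
  theta :: real
  nu :: real
  sig :: real
  eta :: real
  lam_bar :: real
  eps_tol :: real

definition valid_input :: "('w, 'n::finite, 't) model \<Rightarrow> alg_input \<Rightarrow> bool" where
  "valid_input P Q \<longleftrightarrow>
     0 \<le> theta Q \<and> theta Q < 1 \<and> 0 < nu Q \<and> 0 < sig Q \<and> sig Q < lam2 P + nu Q \<and>
     0 < eta Q \<and> eta Q < 1 \<and> 1 < lam_bar Q \<and> 0 \<le> eps_tol Q"

definition G_hat ::
  "('w, 'n::finite, 't::{finite,linorder}) model \<Rightarrow> alg_input \<Rightarrow> ('n, 't) decision \<Rightarrow> real" where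
  "G_hat P Q x = G\<^sub>\<rho> P x + nu Q / 2 * (norm x)\<^sup>2"

definition extrapolate ::
  "('w, 'n::finite, 't::{finite,linorder}) model \<Rightarrow> alg_input \<Rightarrow>
    ('n, 't) decision \<Rightarrow> ('n, 't) decision \<Rightarrow> ('n, 't) decision" where
  "extrapolate P Q x_prev x =
     (let v = closest_point feasible (x + theta Q *\<^sub>R (x - x_prev))
      in if \<Phi>\<^sub>\<rho> P v > \<Phi>\<^sub>\<rho> P x then x else v)"

text \<open>
  \<open>g\<close> is an admissible outcome of the subgradient computation for \<open>\<psi> P \<alpha> t\<close> at \<open>z\<close>; the
  minimizer \<open>u\<close> and the weights \<open>\<theta>\<^sub>j\<close> of scenarios whose loss equals \<open>u\<close> may be chosen freely.
\<close>
definition cvar_subgrad :: "('w, 'n::finite, 't) model \<Rightarrow> 't \<Rightarrow> real ^ 'n \<Rightarrow> real ^ 'n \<Rightarrow> bool" where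
  "cvar_subgrad P t z g \<longleftrightarrow>
     (\<exists>u \<theta>. is_arg_min (cvar_fun P (alpha P) t z) (\<lambda>_. True) u \<and>
        (\<forall>j\<in>{1..nsc P t}.
           (loss P t j z > u \<longrightarrow> \<theta> j = 1) \<and>
           (loss P t j z = u \<longrightarrow> 0 \<le> \<theta> j \<and> \<theta> j \<le> 1) \<and>
           (loss P t j z < u \<longrightarrow> \<theta> j = 0)) \<and>
        (\<Sum>j=1..nsc P t. pr P t j * \<theta> j) = 1 - alpha P \<and>
        g = - ((1 / (1 - alpha P)) *\<^sub>R (\<Sum>j=1..nsc P t. (pr P t j * \<theta> j) *\<^sub>R scen P t j)))"

definition dc_step ::
  "('w, 'n::finite, 't::{finite,linorder}) model \<Rightarrow> alg_input \<Rightarrow>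
    ('n, 't) decision \<Rightarrow> ('n, 't) decision \<Rightarrow> bool" where
  "dc_step P Q w y \<longleftrightarrow>
     (\<exists>g. (\<forall>t. cvar_subgrad P t (w $ t) (g t)) \<and>
        (let s = (rho P * B\<^sub>\<gamma> P) *\<^sub>R (\<chi> t. g t);
             u = s + nu Q *\<^sub>R w
         in is_arg_min (\<lambda>x. G_hat P Q x - u \<bullet> x) (\<lambda>x. x \<in> feasible) y))"

definition stops :: "alg_input \<Rightarrow> ('n::finite, 't::finite) decision \<Rightarrow> ('n, 't) decision \<Rightarrow> bool" where
  "stops Q w d \<longleftrightarrow> norm d = 0 \<or> (eps_tol Q > 0 \<and> norm d \<le> eps_tol Q * max 1 (norm w))"

text \<open>For \<open>w, w + d \<in> feasible\<close> and \<open>d \<noteq> 0\<close>, the supremum is a maximum, as \<open>feasible\<close> is compact.\<close>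
definition lam_max :: "('n::finite, 't::finite) decision \<Rightarrow> ('n, 't) decision \<Rightarrow> real" where
  "lam_max w d = Sup {l. 1 \<le> l \<and> w + l *\<^sub>R d \<in> feasible}"

text \<open>\<open>Some l\<close> is the value of the step length on exit from the backtracking loop.\<close>
definition line_search ::
  "('w, 'n::finite, 't::{finite,linorder}) model \<Rightarrow> alg_input \<Rightarrow>
    ('n, 't) decision \<Rightarrow> ('n, 't) decision \<Rightarrow> ('n, 't) decision \<Rightarrow> real option" where
  "line_search P Q w y d =
     while_option
       (\<lambda>l. l > 1 \<and> \<Phi>\<^sub>\<rho> P (w + l *\<^sub>R d) > min (\<Phi>\<^sub>\<rho> P y) (\<Phi>\<^sub>\<rho> P w - sig Q * l\<^sup>2 * (norm d)\<^sup>2))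
       (\<lambda>l. max 1 (eta Q * l))
       (min (lam_bar Q) (lam_max w d))"

text \<open>
  The sequences are the trace of a run that never returns; the convention that the iterate with
  index \<open>-1\<close> equals \<open>x 0\<close> is built into the first argument of \<open>extrapolate\<close>.
\<close>
definition infinite_run ::
  "('w, 'n::finite, 't::{finite,linorder}) model \<Rightarrow> alg_input \<Rightarrow>
    (nat \<Rightarrow> ('n, 't) decision) \<Rightarrow> (nat \<Rightarrow> ('n, 't) decision) \<Rightarrow> (nat \<Rightarrow> ('n, 't) decision) \<Rightarrow>
    (nat \<Rightarrow> ('n, 't) decision) \<Rightarrow> (nat \<Rightarrow> real) \<Rightarrow> bool" where
  "infinite_run P Q x w y d lam \<longleftrightarrow>
     x 0 \<in> feasible \<and>
     (\<forall>k. w k = extrapolate P Q (if k = 0 then x 0 else x (k - 1)) (x k) \<and>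
          dc_step P Q (w k) (y k) \<and>
          d k = y k - w k \<and>
          \<not> stops Q (w k) (d k) \<and>
          line_search P Q (w k) (y k) (d k) = Some (lam k) \<and>
          x (Suc k) = w k + lam k *\<^sub>R d k)"

end

theory Submission imports Defs begin

text \<open>
  The choice of \<open>\<gamma>\<close> makes \<open>VaR\<^sub>\<alpha>\<close> a common minimizer of the CVaR problems at the levels
  \<open>\<alpha>\<close> and \<open>\<alpha> - \<gamma>\<close>; eliminating the common expected excess yields the DC decomposition
  \<open>\<Phi>\<^sub>\<rho> = G\<^sub>\<rho> - H\<^sub>\<rho>\<close>. As \<open>y\<close> minimizes a function whose convexity is strong with
  quadratic term \<open>(\<lambda>\<^sub>2 + \<nu>/2) \<parallel>x\<parallel>\<^sup>2\<close>, and the subgradient inequality for \<open>H\<close> gains another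
  \<open>\<nu>/2 \<parallel>d\<parallel>\<^sup>2\<close>, the step to \<open>y\<close> decreases \<open>\<Phi>\<^sub>\<rho>\<close> by at least \<open>(\<lambda>\<^sub>2 + \<nu>) \<parallel>d\<parallel>\<^sup>2\<close>,
  hence by \<open>\<sigma> \<parallel>d\<parallel>\<^sup>2\<close>. The line search either accepts a step longer than \<open>1\<close> with the required
  decrease or falls back to \<open>y\<close>. The sums telescope since \<open>\<Phi>\<^sub>\<rho>\<close> is bounded below on \<open>\<X>\<close>.
\<close>

subsection \<open>Convex functions\<close>

lemma convex_on_linear_comp:
  assumes "convex_on UNIV f" "linear g"
  shows "convex_on UNIV (\<lambda>x. f (g x))"
  using assms by (simp add: convex_on_def linear_add linear_scale)

lemma convex_on_sum_fun:
  assumes "\<And>i. i \<in> I \<Longrightarrow> convex_on S (f i)" "convex S"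
  shows "convex_on S (\<lambda>x. \<Sum>i\<in>I. f i x :: real)"
  using assms by (induction I rule: infinite_finite_induct) (auto simp: convex_on_const)

lemma convex_on_max:
  fixes f g :: "'a::real_vector \<Rightarrow> real"
  assumes "convex_on S f" "convex_on S g"
  shows "convex_on S (\<lambda>x. max (f x) (g x))"
proof (rule convex_onI)
  fix s :: real and x y assume s: "0 < s" "s < 1" and xy: "x \<in> S" "y \<in> S"
  let ?m = "\<lambda>x. max (f x) (g x)"
  have "f ((1 - s) *\<^sub>R x + s *\<^sub>R y) \<le> (1 - s) * f x + s * f y"
    "g ((1 - s) *\<^sub>R x + s *\<^sub>R y) \<le> (1 - s) * g x + s * g y"
    using assms s xy by (auto intro: convex_onD)
  moreover have "(1 - s) * f x \<le> (1 - s) * ?m x" "s * f y \<le> s * ?m y"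
    "(1 - s) * g x \<le> (1 - s) * ?m x" "s * g y \<le> s * ?m y"
    using s by (auto intro: mult_left_mono)
  ultimately show "?m ((1 - s) *\<^sub>R x + s *\<^sub>R y) \<le> (1 - s) * ?m x + s * ?m y"
    by simp
qed (use assms in \<open>auto dest: convex_on_imp_convex\<close>)

lemma convex_on_abs_linear:
  fixes g :: "'a::real_vector \<Rightarrow> real"
  assumes "linear g"
  shows "convex_on UNIV (\<lambda>x. \<bar>g x - c\<bar>)"
  using convex_on_linear_comp[OF convex_on_dist[of UNIV c] assms]
  by (simp add: dist_real_def abs_minus_commute)

text \<open>The last term is the exact convexity defect of the squared norm;
  \<open>strongly_convex_minimizer\<close> turns it into its quadratic gain.\<close>

lemma norm_convex_combination:
  fixes x y :: "'a::real_inner"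
  shows "(norm ((1 - s) *\<^sub>R x + s *\<^sub>R y))\<^sup>2
    = (1 - s) * (norm x)\<^sup>2 + s * (norm y)\<^sup>2 - s * (1 - s) * (norm (y - x))\<^sup>2"
  by (simp add: power2_norm_eq_inner inner_add_left inner_add_right inner_diff_left
      inner_diff_right inner_commute algebra_simps)

text \<open>Compare \<open>y\<close> with the point a fraction \<open>s\<close> of the way towards
  \<open>w\<close>, divide by \<open>s\<close> and let \<open>s\<close> tend to 0. As the convex
  remainder is \<open>f\<close> minus \<open>m\<close> times the squared norm, the modulus of strong
  convexity is \<open>2 * m\<close> and the gain is \<open>m\<close>.\<close>

lemma strongly_convex_minimizer:
  fixes f :: "'a::real_inner \<Rightarrow> real"
  assumes conv: "convex_on S (\<lambda>x. f x - m * (norm x)\<^sup>2)"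
    and min: "is_arg_min f (\<lambda>x. x \<in> S) y" and w: "w \<in> S"
  shows "f y + m * (norm (y - w))\<^sup>2 \<le> f w"
proof -
  have y: "y \<in> S" and le: "\<And>x. x \<in> S \<Longrightarrow> f y \<le> f x"
    using min by (auto simp: is_arg_min_linorder)
  have bound: "f y + m * (1 - s) * (norm (w - y))\<^sup>2 \<le> f w" if s: "0 < s" "s < 1" for s
  proof -
    let ?z = "(1 - s) *\<^sub>R y + s *\<^sub>R w"
    have "?z \<in> S"
      using convex_on_imp_convex[OF conv] y w s by (simp add: convex_alt)
    moreover have "f ?z - m * (norm ?z)\<^sup>2
        \<le> (1 - s) * (f y - m * (norm y)\<^sup>2) + s * (f w - m * (norm w)\<^sup>2)"
      using convex_onD[OF conv] s y w by simp
    ultimately have "f y - m * (norm ?z)\<^sup>2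
        \<le> (1 - s) * (f y - m * (norm y)\<^sup>2) + s * (f w - m * (norm w)\<^sup>2)"
      using le[of ?z] by simp
    then have "s * (f y + m * (1 - s) * (norm (w - y))\<^sup>2) \<le> s * f w"
      by (simp only: norm_convex_combination) (simp add: algebra_simps)
    then show ?thesis using s by simp
  qed
  \<comment> \<open>For positive \<open>s\<close> the gain carries the factor \<open>1 - s\<close>,
    which disappears only in the limit.\<close>
  have "((\<lambda>s. f y + m * (1 - s) * (norm (w - y))\<^sup>2) \<longlongrightarrow> f y + m * (1 - 0) * (norm (w - y))\<^sup>2)
      (at_right 0)"
    by (intro tendsto_intros)
  moreover have "\<forall>\<^sub>F s in at_right 0. f y + m * (1 - s) * (norm (w - y))\<^sup>2 \<le> f w"
    using eventually_at_right[of 0 1] bound by (auto simp: eventually_at_right_field intro: exI[of _ 1])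
  ultimately have "f y + m * (1 - 0) * (norm (w - y))\<^sup>2 \<le> f w"
    by (rule tendsto_upperbound) simp
  then show ?thesis by (simp add: norm_minus_commute)
qed

subsection \<open>Value at risk as a difference of CVaR functions\<close>

text \<open>\<open>lower\<close> and \<open>upper\<close> say that \<open>v\<close> is a
  \<open>b\<close>-quantile of the loss. They are the sign conditions on the left and right
  derivatives at \<open>v\<close> of the convex, piecewise linear function
  \<open>cvar_fun P b t z\<close>.\<close>

lemma cvar_fun_minimizer:
  assumes b: "b < 1" and p: "\<And>j. j \<in> {1..nsc P t} \<Longrightarrow> 0 \<le> pr P t j"
    and total: "(\<Sum>j=1..nsc P t. pr P t j) = 1"
    and lower: "(\<Sum>j | j \<in> {1..nsc P t} \<and> loss P t j z < v. pr P t j) \<le> b"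
    and upper: "b \<le> (\<Sum>j | j \<in> {1..nsc P t} \<and> loss P t j z \<le> v. pr P t j)"
  shows "cvar_fun P b t z v \<le> cvar_fun P b t z u"
proof -
  \<comment> \<open>\<open>h j\<close> is minus the one-sided derivative of \<open>u \<mapsto> pos_part (loss P t j z - u)\<close> at \<open>v\<close>, taken
    in the direction of \<open>u\<close>\<close>
  define C where "C j \<longleftrightarrow> (if v \<le> u then loss P t j z \<le> v else loss P t j z < v)" for j
  define h :: "nat \<Rightarrow> real" where "h j = (if C j then 0 else 1)" for j
  let ?p = "pr P t" and ?J = "{1..nsc P t}" and ?L = "\<lambda>j. loss P t j z"
  have "(\<Sum>j\<in>?J. ?p j * h j) = (\<Sum>j\<in>?J. ?p j - (if C j then ?p j else 0))"
    by (intro sum.cong) (auto simp: h_def)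
  also have "\<dots> = 1 - (\<Sum>j | j \<in> ?J \<and> C j. ?p j)"
    by (simp only: sum_subtractf total sum.inter_filter[OF finite_atLeastAtMost])
  finally have mass: "(\<Sum>j\<in>?J. ?p j * h j) = 1 - (\<Sum>j | j \<in> ?J \<and> C j. ?p j)" .
  have dir: "(u - v) * (\<Sum>j\<in>?J. ?p j * h j) \<le> (u - v) * (1 - b)"
  proof (cases "v \<le> u")
    case True
    then show ?thesis
      unfolding mass using upper by (intro mult_left_mono) (auto simp: C_def)
  next
    case False
    then show ?thesis
      unfolding mass using lower by (intro mult_left_mono_neg) (auto simp: C_def)
  qed
  have "pos_part (?L j - v) - h j * (u - v) \<le> pos_part (?L j - u)" for j
    by (auto simp: pos_part_def h_def C_def)
  then have weighted: "(\<Sum>j\<in>?J. ?p j * (pos_part (?L j - v) - h j * (u - v))) \<le> (\<Sum>j\<in>?J. ?p j * pos_part (?L j - u))"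
    using p by (intro sum_mono mult_left_mono) auto
  have "(\<Sum>j\<in>?J. ?p j * pos_part (?L j - v)) - (u - v) * (\<Sum>j\<in>?J. ?p j * h j)
      \<le> (\<Sum>j\<in>?J. ?p j * pos_part (?L j - u))"
  proof -
    have "?p j * (a - h j * (u - v)) = ?p j * a - (u - v) * (?p j * h j)" for a j
      by (simp add: algebra_simps)
    then show ?thesis
      using weighted by (simp only: sum_subtractf flip: sum_distrib_left)
  qed
  with dir have "(\<Sum>j\<in>?J. ?p j * pos_part (?L j - v)) - (u - v) * (1 - b)
      \<le> (\<Sum>j\<in>?J. ?p j * pos_part (?L j - u))"
    by linarith
  then have "(\<Sum>j\<in>?J. ?p j * pos_part (?L j - v)) / (1 - b)
      \<le> ((\<Sum>j\<in>?J. ?p j * pos_part (?L j - u)) + (u - v) * (1 - b)) / (1 - b)"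
    using b by (intro divide_right_mono) auto
  with b show ?thesis
    by (simp add: cvar_fun_def add_divide_distrib)
qed

lemma \<psi>_eq_minimum:
  assumes "\<And>u. cvar_fun P b t z v \<le> cvar_fun P b t z u"
  shows "\<psi> P b t z = cvar_fun P b t z v"
  unfolding \<psi>_def using assms by (intro cInf_eq_minimum) auto

text \<open>The model gives the law of \<open>rv P t\<close> atom by atom only. The finitely many
  scenario values carry total mass 1, so the event may be restricted to them almost surely; the
  indices are then grouped by value because scenarios may coincide.\<close>

lemma prob_loss_le:
  assumes "valid_model P"
  shows "measure (sp P) {\<omega> \<in> space (sp P). - (rv P t \<omega> \<bullet> z) \<le> u}
    = (\<Sum>j | j \<in> {1..nsc P t} \<and> loss P t j z \<le> u. pr P t j)"
proof -
  interpret prob_space "sp P" using assms by (simp add: valid_model_def)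
  have meas[measurable]: "rv P t \<in> borel_measurable (sp P)"
    and atom: "\<And>v. prob {\<omega> \<in> space (sp P). rv P t \<omega> = v}
      = (\<Sum>j | j \<in> {1..nsc P t} \<and> scen P t j = v. pr P t j)"
    and total: "(\<Sum>j=1..nsc P t. pr P t j) = 1"
    using assms by (auto simp: valid_model_def)
  let ?J = "{1..nsc P t}"
  have fin_union: "prob {\<omega> \<in> space (sp P). rv P t \<omega> \<in> V} = (\<Sum>j | j \<in> ?J \<and> scen P t j \<in> V. pr P t j)"
    if V: "finite V" for V
  proof -
    have "{\<omega> \<in> space (sp P). rv P t \<omega> \<in> V} = (\<Union>v\<in>V. {\<omega> \<in> space (sp P). rv P t \<omega> = v})"
      by auto
    also have "prob \<dots> = (\<Sum>v\<in>V. prob {\<omega> \<in> space (sp P). rv P t \<omega> = v})"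
      using V by (intro finite_measure_finite_Union) (auto simp: disjoint_family_on_def)
    also have "\<dots> = (\<Sum>v\<in>V. \<Sum>j | j \<in> {j \<in> ?J. scen P t j \<in> V} \<and> scen P t j = v. pr P t j)"
      unfolding atom by (intro sum.cong refl) auto
    also have "\<dots> = (\<Sum>j | j \<in> ?J \<and> scen P t j \<in> V. pr P t j)"
      using V by (intro sum.group) auto
    finally show ?thesis .
  qed
  let ?V = "scen P t ` ?J"
  have [measurable]: "?V \<in> sets borel" "{v \<in> ?V. - (v \<bullet> z) \<le> u} \<in> sets borel"
    by (intro borel_closed finite_imp_closed; simp)+
  have "{j \<in> ?J. scen P t j \<in> ?V} = ?J" by auto
  then have "prob {\<omega> \<in> space (sp P). rv P t \<omega> \<in> ?V} = 1"
    using fin_union[of ?V] total by simp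
  then have "AE \<omega> in sp P. rv P t \<omega> \<in> ?V"
    by (subst (asm) prob_Collect_eq_1) measurable
  then have "prob {\<omega> \<in> space (sp P). - (rv P t \<omega> \<bullet> z) \<le> u}
      = prob {\<omega> \<in> space (sp P). rv P t \<omega> \<in> {v \<in> ?V. - (v \<bullet> z) \<le> u}}"
  proof (intro finite_measure_eq_AE)
    show "{\<omega> \<in> space (sp P). - (rv P t \<omega> \<bullet> z) \<le> u} \<in> events"
      "{\<omega> \<in> space (sp P). rv P t \<omega> \<in> {v \<in> ?V. - (v \<bullet> z) \<le> u}} \<in> events"
      by measurable
  qed auto
  also have "\<dots> = (\<Sum>j | j \<in> ?J \<and> loss P t j z \<le> u. pr P t j)"
    by (subst fin_union) (auto simp: loss_def intro!: sum.cong)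
  finally show ?thesis .
qed

text \<open>The value at risk is a quantile at both levels: losses strictly below it have mass less
  than \<open>alpha P\<close>, and since subset sums skip the interval of length
  \<open>eps_bar P t\<close> below \<open>alpha P\<close>, that mass is even at most
  \<open>alpha P - gam P\<close>.\<close>

lemma VaR_minimizes_cvar_fun:
  assumes valid: "valid_model P" and b: "b \<in> {alpha P - gam P, alpha P}"
  shows "cvar_fun P b t z (VaR (sp P) (alpha P) (\<lambda>\<omega>. - (rv P t \<omega> \<bullet> z))) \<le> cvar_fun P b t z u"
proof -
  let ?J = "{1..nsc P t}" and ?L = "\<lambda>j. loss P t j z" and ?p = "pr P t"
  have ne: "?J \<noteq> {}" and p: "\<And>j. j \<in> ?J \<Longrightarrow> 0 < ?p j" and total: "sum ?p ?J = 1"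
    and al: "0 < alpha P" "alpha P < 1" and ga: "0 < gam P" "gam P < Min (range (eps_bar P))"
    using valid by (auto simp: valid_model_def)
  define F where "F u = (\<Sum>j | j \<in> ?J \<and> ?L j \<le> u. ?p j)" for u
  have F_mono: "F u \<le> F u'" if "u \<le> u'" for u u'
    unfolding F_def using that p by (intro sum_mono2) (auto intro: less_imp_le)
  define V where "V = {l \<in> ?L ` ?J. alpha P \<le> F l}"
  define v where "v = Min V"
  \<comment> \<open>Lowering \<open>u\<close> to the largest loss not above it leaves
    \<open>F\<close> unchanged, and such a loss exists because \<open>alpha P\<close> is positive.
    The infimum over all reals thus becomes the minimum of the finite set \<open>V\<close>.\<close>
  have attained: "\<exists>l\<in>V. l \<le> u" if u: "alpha P \<le> F u" for u
  proof -
    let ?K = "{j \<in> ?J. ?L j \<le> u}"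
    have "?K \<noteq> {}"
    proof
      assume "?K = {}"
      then have "F u = 0" unfolding F_def by (simp only: sum.empty)
      then show False using u al by simp
    qed
    then have m: "Max (?L ` ?K) \<in> ?L ` ?K" by (intro Max_in) auto
    have "{j \<in> ?J. ?L j \<le> Max (?L ` ?K)} = ?K"
      using m by (auto intro: Max_ge)
    then have "F (Max (?L ` ?K)) = F u" by (simp add: F_def)
    with m u show ?thesis by (intro bexI[of _ "Max (?L ` ?K)"]) (auto simp: V_def)
  qed
  have "{j \<in> ?J. ?L j \<le> Max (?L ` ?J)} = ?J" by auto
  then have "F (Max (?L ` ?J)) = 1" using total by (simp add: F_def)
  then have "V \<noteq> {}" using attained[of "Max (?L ` ?J)"] al by auto
  moreover have "finite V" by (simp add: V_def)
  ultimately have vV: "v \<in> V" and v_le: "\<And>l. l \<in> V \<Longrightarrow> v \<le> l"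
    by (auto simp: v_def)
  then have Fv: "alpha P \<le> F v" by (simp add: V_def)
  have "VaR (sp P) (alpha P) (\<lambda>\<omega>. - (rv P t \<omega> \<bullet> z)) = Inf {u. alpha P \<le> F u}"
    by (simp add: VaR_def prob_loss_le[OF valid] F_def)
  also have "\<dots> = v"
    using Fv attained v_le by (intro cInf_eq_minimum) fastforce+
  finally have VaR: "VaR (sp P) (alpha P) (\<lambda>\<omega>. - (rv P t \<omega> \<bullet> z)) = v" .
  let ?K = "{j \<in> ?J. ?L j < v}"
  \<comment> \<open>Otherwise the largest loss below \<open>v\<close> would itself lie in
    \<open>V\<close>, contradicting the minimality of \<open>v\<close>.\<close>
  have strict: "sum ?p ?K < alpha P"
  proof (cases "?K = {}")
    case False
    then have m: "Max (?L ` ?K) \<in> ?L ` ?K" by (intro Max_in) auto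
    have "{j \<in> ?J. ?L j \<le> Max (?L ` ?K)} = ?K"
      using m by (auto intro: Max_ge)
    then have "F (Max (?L ` ?K)) = sum ?p ?K" by (simp add: F_def)
    moreover have "Max (?L ` ?K) \<notin> V" using v_le m by fastforce
    ultimately show ?thesis using m by (auto simp: V_def)
  qed (use al in \<open>simp only: sum.empty\<close>)
  \<comment> \<open>The set \<open>?K\<close> competes in the maximum defining
    \<open>eps_bar\<close>; finiteness of the competing sums is needed for
    \<open>Max_ge\<close>.\<close>
  have "{sum ?p J | J. J \<subseteq> ?J \<and> sum ?p J < alpha P} \<subseteq> sum ?p ` Pow ?J" by auto
  then have "finite {sum ?p J | J. J \<subseteq> ?J \<and> sum ?p J < alpha P}"
    by (rule finite_subset) simp
  then have "sum ?p ?K \<le> Max {sum ?p J | J. J \<subseteq> ?J \<and> sum ?p J < alpha P}"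
    using strict by (intro Max_ge) auto
  moreover have "gam P < eps_bar P t" using ga by simp
  ultimately have "sum ?p ?K \<le> alpha P - gam P"
    unfolding eps_bar_def by linarith
  then show ?thesis
    unfolding VaR using b al ga p total Fv
    by (intro cvar_fun_minimizer) (auto simp: F_def intro: less_imp_le)
qed

text \<open>With a common minimizer, both CVaR values are \<open>?v + E / (1 - b)\<close> for the
  same expected excess \<open>E\<close>. The factors \<open>A\<^sub>\<gamma>\<close> and
  \<open>B\<^sub>\<gamma>\<close> turn the excess into \<open>E / gam P\<close> in both, so it
  cancels, and they differ by 1.\<close>

lemma VaR_eq_cvar_difference:
  assumes "valid_model P"
  shows "VaR (sp P) (alpha P) (\<lambda>\<omega>. - (rv P t \<omega> \<bullet> z))
    = A\<^sub>\<gamma> P * \<psi> P (alpha P - gam P) t z - B\<^sub>\<gamma> P * \<psi> P (alpha P) t z"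
proof -
  let ?v = "VaR (sp P) (alpha P) (\<lambda>\<omega>. - (rv P t \<omega> \<bullet> z))"
  define E where "E = (\<Sum>j=1..nsc P t. pr P t j * pos_part (loss P t j z - ?v))"
  have al: "alpha P < 1" "0 < gam P" using assms by (auto simp: valid_model_def)
  have \<psi>: "\<psi> P b t z = ?v + E / (1 - b)" if "b \<in> {alpha P - gam P, alpha P}" for b
    using \<psi>_eq_minimum[OF VaR_minimizes_cvar_fun[OF assms that]] by (simp add: cvar_fun_def E_def)
  define a where "a = 1 - alpha P + gam P"
  have "0 < a" using al by (simp add: a_def)
  moreover have "\<psi> P (alpha P - gam P) t z = ?v + E / a"
    using \<psi>[of "alpha P - gam P"] by (simp add: a_def algebra_simps)
  ultimately have "A\<^sub>\<gamma> P * \<psi> P (alpha P - gam P) t z = (a * ?v + E) / gam P"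
    using al by (simp add: A\<^sub>\<gamma>_def distrib_left add_divide_distrib flip: a_def)
  moreover have "B\<^sub>\<gamma> P * \<psi> P (alpha P) t z = ((1 - alpha P) * ?v + E) / gam P"
    using al by (simp add: \<psi> B\<^sub>\<gamma>_def distrib_left add_divide_distrib)
  ultimately have "A\<^sub>\<gamma> P * \<psi> P (alpha P - gam P) t z - B\<^sub>\<gamma> P * \<psi> P (alpha P) t z
      = (a * ?v + E - ((1 - alpha P) * ?v + E)) / gam P"
    by (simp only: diff_divide_distrib)
  also have "\<dots> = ?v"
    using al by (simp add: a_def field_simps)
  finally show ?thesis by simp
qed

text \<open>In each period this is the identity \<open>max (a - b) 0 = max a b - b\<close>.\<close>

lemma \<Phi>_dc_decomposition:
  assumes "valid_model P"
  shows "\<Phi>\<^sub>\<rho> P x = G\<^sub>\<rho> P x - rho P * B\<^sub>\<gamma> P * (\<Sum>t\<in>UNIV. \<psi> P (alpha P) t (x $ t))"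
proof -
  have "var_penalty P x = (\<Sum>t\<in>UNIV. max (A\<^sub>\<gamma> P * \<psi> P (alpha P - gam P) t (x $ t) - tau P)
      (B\<^sub>\<gamma> P * \<psi> P (alpha P) t (x $ t)) - B\<^sub>\<gamma> P * \<psi> P (alpha P) t (x $ t))"
    unfolding var_penalty_def by (intro sum.cong) (auto simp: VaR_eq_cvar_difference[OF assms] pos_part_def)
  then show ?thesis
    by (simp add: \<Phi>\<^sub>\<rho>_def G\<^sub>\<rho>_def sum_subtractf sum_distrib_left right_diff_distrib mult.assoc)
qed

subsection \<open>Convexity and subgradients\<close>

text \<open>Convexity in \<open>z\<close> and \<open>u\<close> together is what survives
  minimization over \<open>u\<close>; it is used for \<open>convex_on_\<psi>\<close>.\<close>

lemma cvar_fun_jointly_convex: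
  assumes b: "b < 1" and p: "\<And>j. j \<in> {1..nsc P t} \<Longrightarrow> 0 \<le> pr P t j" and s: "0 \<le> s" "s \<le> 1"
  shows "cvar_fun P b t ((1 - s) *\<^sub>R z + s *\<^sub>R z') ((1 - s) * u + s * u')
    \<le> (1 - s) * cvar_fun P b t z u + s * cvar_fun P b t z' u'"
proof -
  have "pos_part (loss P t j ((1 - s) *\<^sub>R z + s *\<^sub>R z') - ((1 - s) * u + s * u'))
      \<le> (1 - s) * pos_part (loss P t j z - u) + s * pos_part (loss P t j z' - u')" for j
  proof -
    have "loss P t j ((1 - s) *\<^sub>R z + s *\<^sub>R z') - ((1 - s) * u + s * u')
        = (1 - s) * (loss P t j z - u) + s * (loss P t j z' - u')"
      by (simp add: loss_def inner_add_right algebra_simps)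
    moreover have "(1 - s) * (loss P t j z - u) \<le> (1 - s) * pos_part (loss P t j z - u)"
      "s * (loss P t j z' - u') \<le> s * pos_part (loss P t j z' - u')"
      "0 \<le> (1 - s) * pos_part (loss P t j z - u)" "0 \<le> s * pos_part (loss P t j z' - u')"
      using s by (auto intro!: mult_left_mono mult_nonneg_nonneg simp: pos_part_def)
    ultimately show ?thesis by (simp add: pos_part_def)
  qed
  then have "(\<Sum>j=1..nsc P t. pr P t j * pos_part (loss P t j ((1 - s) *\<^sub>R z + s *\<^sub>R z') - ((1 - s) * u + s * u')))
      \<le> (\<Sum>j=1..nsc P t. pr P t j * ((1 - s) * pos_part (loss P t j z - u) + s * pos_part (loss P t j z' - u')))"
    using p by (intro sum_mono mult_left_mono) auto
  also have "\<dots> = (1 - s) * (\<Sum>j=1..nsc P t. pr P t j * pos_part (loss P t j z - u))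
      + s * (\<Sum>j=1..nsc P t. pr P t j * pos_part (loss P t j z' - u'))"
    by (simp add: sum_distrib_left distrib_left sum.distrib mult_ac)
  finally have bound: "1 / (1 - b) * (\<Sum>j=1..nsc P t. pr P t j * pos_part (loss P t j ((1 - s) *\<^sub>R z + s *\<^sub>R z') - ((1 - s) * u + s * u')))
      \<le> 1 / (1 - b) * ((1 - s) * (\<Sum>j=1..nsc P t. pr P t j * pos_part (loss P t j z - u))
      + s * (\<Sum>j=1..nsc P t. pr P t j * pos_part (loss P t j z' - u')))"
    using b by (intro mult_left_mono) auto
  have expand: "(1 - s) * (u + c * a) + s * (u' + c * a')
      = (1 - s) * u + s * u' + c * ((1 - s) * a + s * a')" for c a a' :: real
    by (simp add: algebra_simps)
  show ?thesis
    unfolding cvar_fun_def expand using bound by (rule add_left_mono)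
qed

text \<open>Partial minimization of a jointly convex function. At the two levels concerned the value
  at risk supplies a minimizer at each endpoint, and the convex combination of these is a competitor
  at the intermediate point.\<close>

lemma convex_on_\<psi>:
  fixes P :: "('w, 'n::finite, 't::{finite,linorder}) model"
  assumes valid: "valid_model P" and b: "b \<in> {alpha P - gam P, alpha P}"
  shows "convex_on UNIV (\<psi> P b t)"
proof (rule convex_onI)
  fix s :: real and z z' :: "real ^ 'n" assume s: "0 < s" "s < 1"
  define v where "v z = VaR (sp P) (alpha P) (\<lambda>\<omega>. - (rv P t \<omega> \<bullet> z))" for z
  have min: "cvar_fun P b t z (v z) \<le> cvar_fun P b t z u" for z u
    unfolding v_def by (rule VaR_minimizes_cvar_fun[OF valid b])
  then have eq: "\<psi> P b t z = cvar_fun P b t z (v z)" for z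
    by (intro \<psi>_eq_minimum)
  let ?z = "(1 - s) *\<^sub>R z + s *\<^sub>R z'"
  have "\<psi> P b t ?z \<le> cvar_fun P b t ?z ((1 - s) * v z + s * v z')"
    unfolding eq by (rule min)
  also have "\<dots> \<le> (1 - s) * cvar_fun P b t z (v z) + s * cvar_fun P b t z' (v z')"
    using valid b s by (intro cvar_fun_jointly_convex) (auto simp: valid_model_def intro: less_imp_le)
  finally show "\<psi> P b t ?z \<le> (1 - s) * \<psi> P b t z + s * \<psi> P b t z'"
    by (simp add: eq)
qed simp

text \<open>
  \<open>\<psi>\<close> is positively homogeneous, so a subgradient \<open>g\<close> at \<open>z\<close> satisfies \<open>\<psi> z = g \<bullet> z\<close> and
  supports \<open>\<psi>\<close> linearly.
\<close>
lemma cvar_subgrad_support: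
  assumes valid: "valid_model P" and sub: "cvar_subgrad P t z g"
  shows "\<psi> P (alpha P) t z = g \<bullet> z" and "g \<bullet> z' \<le> \<psi> P (alpha P) t z'"
proof -
  let ?J = "{1..nsc P t}" and ?p = "pr P t" and ?c = "1 / (1 - alpha P)"
  obtain u \<theta> where min: "is_arg_min (cvar_fun P (alpha P) t z) (\<lambda>_. True) u"
    and \<theta>: "\<And>j. j \<in> ?J \<Longrightarrow> (loss P t j z > u \<longrightarrow> \<theta> j = 1) \<and>
      (loss P t j z = u \<longrightarrow> 0 \<le> \<theta> j \<and> \<theta> j \<le> 1) \<and> (loss P t j z < u \<longrightarrow> \<theta> j = 0)"
    and mass: "(\<Sum>j\<in>?J. ?p j * \<theta> j) = 1 - alpha P"
    and g: "g = - (?c *\<^sub>R (\<Sum>j\<in>?J. (?p j * \<theta> j) *\<^sub>R scen P t j))"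
    using sub unfolding cvar_subgrad_def by blast
  have al: "alpha P < 1" and p: "\<And>j. j \<in> ?J \<Longrightarrow> 0 < ?p j"
    using valid by (auto simp: valid_model_def)
  \<comment> \<open>The weights have mass \<open>1 - alpha P\<close>, so shifting all losses by
    \<open>u'\<close> is compensated exactly and \<open>u'\<close> stays free. It is taken as the
    minimizer \<open>u\<close> at \<open>z\<close> and as an arbitrary level at
    \<open>z'\<close>.\<close>
  have g_inner: "g \<bullet> z' = u' + ?c * (\<Sum>j\<in>?J. ?p j * \<theta> j * (loss P t j z' - u'))" for z' u'
  proof -
    have "(\<Sum>j\<in>?J. ?p j * \<theta> j * (loss P t j z' - u'))
        = - (\<Sum>j\<in>?J. ?p j * \<theta> j * (scen P t j \<bullet> z')) - (1 - alpha P) * u'"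
      unfolding mass[symmetric]
      by (simp add: loss_def right_diff_distrib sum_distrib_right sum_subtractf sum_negf)
    then show ?thesis
      using al by (simp only: g) (simp add: inner_sum_left field_simps)
  qed
  have "\<psi> P (alpha P) t z = cvar_fun P (alpha P) t z u"
    using min by (intro \<psi>_eq_minimum) (simp add: is_arg_min_linorder)
  also have "\<dots> = u + ?c * (\<Sum>j\<in>?J. ?p j * \<theta> j * (loss P t j z - u))"
  proof -
    \<comment> \<open>The weight is 1 where the excess is positive and 0 where it is negative; at a
      tie both sides vanish.\<close>
    have "?p j * pos_part (loss P t j z - u) = ?p j * \<theta> j * (loss P t j z - u)" if "j \<in> ?J" for j
      using \<theta>[OF that] by (auto simp: pos_part_def max_def)
    then have "(\<Sum>j\<in>?J. ?p j * pos_part (loss P t j z - u)) = (\<Sum>j\<in>?J. ?p j * \<theta> j * (loss P t j z - u))"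
      by (rule sum.cong[OF refl])
    then show ?thesis by (simp only: cvar_fun_def)
  qed
  finally show "\<psi> P (alpha P) t z = g \<bullet> z"
    by (simp add: g_inner[of z u])
  have "g \<bullet> z' \<le> cvar_fun P (alpha P) t z' u'" for u'
  proof -
    have "?p j * \<theta> j * (loss P t j z' - u') \<le> ?p j * pos_part (loss P t j z' - u')" if "j \<in> ?J" for j
    proof -
      have "0 \<le> \<theta> j" "\<theta> j \<le> 1"
        using \<theta>[OF that] by (cases "loss P t j z" u rule: linorder_cases; simp)+
      then have "\<theta> j * (loss P t j z' - u') \<le> pos_part (loss P t j z' - u')"
        by (cases "loss P t j z' \<ge> u'")
          (auto simp: pos_part_def max_def mult_left_le_one_le mult_nonneg_nonpos)
      then show ?thesis using p[OF that] by (simp add: mult.assoc)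
    qed
    then have "(\<Sum>j\<in>?J. ?p j * \<theta> j * (loss P t j z' - u')) \<le> (\<Sum>j\<in>?J. ?p j * pos_part (loss P t j z' - u'))"
      by (rule sum_mono)
    then show ?thesis
      unfolding g_inner[of z' u'] cvar_fun_def using al by (intro add_left_mono mult_left_mono) auto
  qed
  then show "g \<bullet> z' \<le> \<psi> P (alpha P) t z'"
    unfolding \<psi>_def by (intro cINF_greatest) auto
qed

lemma norm_vec_power2: "(norm x)\<^sup>2 = (\<Sum>t\<in>UNIV. (norm (x $ t))\<^sup>2)"
  for x :: "'a::real_inner ^ 't::finite"
  by (simp add: power2_norm_eq_inner inner_vec_def)

lemma convex_on_obj:
  fixes P :: "('w, 'n::finite, 't::{finite,linorder}) model"
  assumes "valid_model P"
  shows "convex_on UNIV (\<lambda>x. obj P x - lam2 P * (norm x)\<^sup>2)"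
proof -
  have lin: "linear (\<lambda>x::('n, 't) decision. - (\<Sum>t\<in>UNIV. mean P t \<bullet> x $ t))"
    by (intro linearI) (simp_all add: inner_add_right sum.distrib sum_distrib_left sum_negf)
  \<comment> \<open>The trailing \<open>- 0\<close> gives the turnover terms between periods the
    shape of \<open>convex_on_abs_linear\<close>.\<close>
  have "convex_on UNIV (\<lambda>x::('n, 't) decision. - (\<Sum>t\<in>UNIV. mean P t \<bullet> x $ t)
     + lam1 P * ((\<Sum>i\<in>UNIV. cost P $ i * \<bar>x $ first_period $ i - wprev P $ i\<bar>)
        + (\<Sum>t\<in>UNIV - {first_period}. \<Sum>i\<in>UNIV. cost P $ i * \<bar>x $ t $ i - x $ prev_period t $ i - 0\<bar>)))"
    using assms
    by (intro convex_on_add convex_on_cmul convex_on_sum_fun convex_on_abs_linear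
        convex_on_linear_comp[OF _ lin])
      (auto simp: valid_model_def convex_on_ident algebra_simps intro!: linearI)
  then show ?thesis by (simp add: obj_def norm_vec_power2)
qed

text \<open>Subtracting the quadratic terms of \<open>obj\<close> and of the proximal term leaves
  sums and maxima of convex functions and a linear tilt. This is the form that
  \<open>strongly_convex_minimizer\<close> takes.\<close>

lemma convex_on_G_hat:
  fixes P :: "('w, 'n::finite, 't::{finite,linorder}) model"
  assumes valid: "valid_model P"
  shows "convex_on UNIV (\<lambda>x. G_hat P Q x - u \<bullet> x - (lam2 P + nu Q / 2) * (norm x)\<^sup>2)"
proof -
  have lin: "linear (\<lambda>x. - (u \<bullet> x))"
    by (intro linearI) (simp_all add: inner_add_right)
  have B: "0 \<le> B\<^sub>\<gamma> P" "0 \<le> A\<^sub>\<gamma> P" "0 \<le> rho P"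
    using valid by (auto simp: valid_model_def A\<^sub>\<gamma>_def B\<^sub>\<gamma>_def)
  have \<psi>: "convex_on UNIV (\<lambda>x::('n, 't) decision. \<psi> P b t (x $ t))" if "b \<in> {alpha P - gam P, alpha P}" for b t
    by (rule convex_on_linear_comp[OF convex_on_\<psi>[OF valid that]]) (auto intro!: linearI)
  have "convex_on UNIV (\<lambda>x. (obj P x - lam2 P * (norm x)\<^sup>2) + rho P * (\<Sum>t\<in>UNIV.
     max (A\<^sub>\<gamma> P * \<psi> P (alpha P - gam P) t (x $ t) + - tau P) (B\<^sub>\<gamma> P * \<psi> P (alpha P) t (x $ t)))
     + - (u \<bullet> x))"
    using B
    by (intro convex_on_add convex_on_obj[OF valid] convex_on_cmul convex_on_sum_fun convex_on_max \<psi>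
        convex_on_linear_comp[OF _ lin]) (auto simp: convex_on_ident convex_on_const)
  then show ?thesis by (simp add: G_hat_def G\<^sub>\<rho>_def algebra_simps)
qed

lemma convex_feasible: "convex (feasible :: ('n::finite, 't::finite) decision set)"
proof -
  have "convex (unit_simplex :: (real ^ 'n) set)"
    by (auto simp: convex_def unit_simplex_def sum.distrib simp flip: sum_distrib_left)
  then show ?thesis by (simp add: convex_def feasible_def)
qed

text \<open>The tilt \<open>?u\<close> cancels between the minimality of \<open>y\<close>
  (\<open>G\<close>) and the linearization of the concave part at \<open>w\<close> (\<open>H\<close>
  and \<open>N\<close>).\<close>

lemma dc_step_descent:
  fixes w y :: "('n::finite, 't::{finite,linorder}) decision"
  assumes valid: "valid_model P" and step: "dc_step P Q w y" and w: "w \<in> feasible"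
  shows "y \<in> feasible"
    and "\<Phi>\<^sub>\<rho> P y + (lam2 P + nu Q) * (norm (y - w))\<^sup>2 \<le> \<Phi>\<^sub>\<rho> P w"
proof -
  obtain g where g: "\<And>t. cvar_subgrad P t (w $ t) (g t)"
    and min: "is_arg_min (\<lambda>x. G_hat P Q x - ((rho P * B\<^sub>\<gamma> P) *\<^sub>R (\<chi> t. g t) + nu Q *\<^sub>R w) \<bullet> x)
      (\<lambda>x. x \<in> feasible) y"
    using step by (auto simp: dc_step_def Let_def)
  let ?u = "(rho P * B\<^sub>\<gamma> P) *\<^sub>R (\<chi> t. g t) + nu Q *\<^sub>R w"
  let ?h = "\<lambda>x. \<Sum>t\<in>UNIV. \<psi> P (alpha P) t (x $ t)"
  show "y \<in> feasible" using min by (simp add: is_arg_min_linorder)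
  have G: "G_hat P Q y - ?u \<bullet> y + (lam2 P + nu Q / 2) * (norm (y - w))\<^sup>2 \<le> G_hat P Q w - ?u \<bullet> w"
    by (rule strongly_convex_minimizer[OF convex_on_subset[OF convex_on_G_hat[OF valid]] min w])
      (simp_all add: convex_feasible)
  have c: "0 \<le> rho P * B\<^sub>\<gamma> P" using valid by (simp add: valid_model_def B\<^sub>\<gamma>_def)
  have inner: "(\<chi> t. g t) \<bullet> v = (\<Sum>t\<in>UNIV. g t \<bullet> v $ t)" for v :: "('n, 't) decision"
    by (simp add: inner_vec_def[of "\<chi> t. g t" v])
  have "(\<chi> t. g t) \<bullet> w = ?h w"
    by (simp add: inner cvar_subgrad_support(1)[OF valid g])
  moreover have "(\<chi> t. g t) \<bullet> y \<le> ?h y"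
    by (simp add: inner cvar_subgrad_support(2)[OF valid g] sum_mono)
  ultimately have "(rho P * B\<^sub>\<gamma> P) * ((\<chi> t. g t) \<bullet> (y - w)) \<le> (rho P * B\<^sub>\<gamma> P) * (?h y - ?h w)"
    using c by (intro mult_left_mono) (auto simp: inner_diff_right)
  then have H: "(rho P * B\<^sub>\<gamma> P) * ((\<chi> t. g t) \<bullet> y) - (rho P * B\<^sub>\<gamma> P) * ((\<chi> t. g t) \<bullet> w)
      \<le> (rho P * B\<^sub>\<gamma> P) * ?h y - (rho P * B\<^sub>\<gamma> P) * ?h w"
    by (simp add: inner_diff_right right_diff_distrib)
  \<comment> \<open>The gap between the proximal quadratic and its linearization at \<open>w\<close>
    is known exactly; it raises the gain from \<open>lam2 P + nu Q / 2\<close> to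
    \<open>lam2 P + nu Q\<close>.\<close>
  have N: "nu Q / 2 * (norm y)\<^sup>2 - nu Q / 2 * (norm w)\<^sup>2 - nu Q * (w \<bullet> y) + nu Q * (w \<bullet> w)
      = nu Q / 2 * (norm (y - w))\<^sup>2"
    by (simp add: power2_norm_eq_inner inner_diff_left inner_diff_right inner_commute field_simps)
  have "(lam2 P + nu Q) * (norm (y - w))\<^sup>2 = (lam2 P + nu Q / 2) * (norm (y - w))\<^sup>2 + nu Q / 2 * (norm (y - w))\<^sup>2"
    by (simp add: algebra_simps)
  then show "\<Phi>\<^sub>\<rho> P y + (lam2 P + nu Q) * (norm (y - w))\<^sup>2 \<le> \<Phi>\<^sub>\<rho> P w"
    using G H N unfolding \<Phi>_dc_decomposition[OF valid] G_hat_def inner_add_left inner_scaleR_left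
    by linarith
qed

subsection \<open>Line search and descent\<close>

lemma unit_simplex_norm_le_1:
  assumes "z \<in> unit_simplex" shows "norm z \<le> 1"
  using assms norm_le_l1_cart[of z] by (simp add: unit_simplex_def)

text \<open>Closedness puts the projection into the feasible set; with boundedness it makes
  \<open>lam_max\<close> an attained maximum.\<close>

lemma compact_feasible: "compact (feasible :: ('n::finite, 't::finite) decision set)"
  unfolding compact_eq_bounded_closed
proof
  have "norm x \<le> CARD('t)" if "x \<in> feasible" for x :: "('n, 't) decision"
  proof -
    have "norm x \<le> (\<Sum>t\<in>UNIV. norm (x $ t))"
      by (simp add: norm_vec_def L2_set_le_sum)
    also have "\<dots> \<le> (\<Sum>t\<in>(UNIV :: 't set). 1)"
      using that by (intro sum_mono unit_simplex_norm_le_1) (simp add: feasible_def)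
    finally show ?thesis by simp
  qed
  then show "bounded (feasible :: ('n, 't) decision set)" by (auto simp: bounded_iff)
  have "feasible = {x :: ('n, 't) decision. (\<forall>t. (\<Sum>i\<in>UNIV. x $ t $ i) = 1) \<and> (\<forall>t i. 0 \<le> x $ t $ i)}"
    by (auto simp: feasible_def unit_simplex_def)
  moreover have "closed \<dots>"
    by (intro closed_Collect_conj closed_Collect_all closed_Collect_eq closed_Collect_le continuous_intros)
  ultimately show "closed (feasible :: ('n, 't) decision set)" by simp
qed

text \<open>As \<open>d\<close> is nonzero, the admissible lengths form a closed bounded set
  containing 1, so the supremum is admissible; shorter steps follow by convexity.\<close>

lemma lam_max_props:
  fixes w d :: "('n::finite, 't::finite) decision"
  assumes w: "w \<in> feasible" and wd: "w + d \<in> feasible" and d: "d \<noteq> 0"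
  shows "1 \<le> lam_max w d"
    and "1 \<le> l \<Longrightarrow> l \<le> lam_max w d \<Longrightarrow> w + l *\<^sub>R d \<in> feasible"
proof -
  let ?S = "{l. 1 \<le> l \<and> w + l *\<^sub>R d \<in> feasible}"
  have one: "1 \<in> ?S" using wd by simp
  obtain B where B: "\<And>x. x \<in> (feasible :: ('n, 't) decision set) \<Longrightarrow> norm x \<le> B"
    using compact_imp_bounded[OF compact_feasible] by (auto simp: bounded_iff)
  have "l \<le> (B + norm w) / norm d" if "l \<in> ?S" for l
  proof -
    have "l * norm d = norm ((w + l *\<^sub>R d) - w)" using that by simp
    also have "\<dots> \<le> B + norm w" using that by (intro norm_triangle_le_diff add_mono B) auto
    finally show ?thesis using d by (simp add: pos_le_divide_eq)
  qed
  then have bdd: "bdd_above ?S" by (rule bdd_aboveI)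
  show "1 \<le> lam_max w d" unfolding lam_max_def by (rule cSup_upper[OF one bdd])
  have "closed ((\<lambda>l. w + l *\<^sub>R d) -` feasible)"
    by (intro closed_vimage compact_imp_closed compact_feasible continuous_intros)
  then have "closed ({1..} \<inter> (\<lambda>l. w + l *\<^sub>R d) -` feasible)" by (intro closed_Int) auto
  moreover have "{1..} \<inter> (\<lambda>l. w + l *\<^sub>R d) -` feasible = ?S" by auto
  ultimately have "closed ?S" by simp
  then have "lam_max w d \<in> ?S"
    unfolding lam_max_def using one bdd by (intro closed_contains_Sup) auto
  then have max: "1 \<le> lam_max w d" "w + lam_max w d *\<^sub>R d \<in> feasible" by auto
  assume l: "1 \<le> l" "l \<le> lam_max w d"
  let ?s = "l / lam_max w d"
  have "(1 - ?s) *\<^sub>R w + ?s *\<^sub>R (w + lam_max w d *\<^sub>R d) \<in> feasible"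
    using max l by (intro convexD_alt[OF convex_feasible w]) auto
  moreover have "(1 - ?s) *\<^sub>R w + ?s *\<^sub>R (w + lam_max w d *\<^sub>R d) = w + l *\<^sub>R d"
    using max l by (simp add: algebra_simps)
  ultimately show "w + l *\<^sub>R d \<in> feasible" by simp
qed

text \<open>Backtracking keeps the length between 1 and \<open>lam_max w d\<close>: it shrinks but
  is cut off at 1. On exit the loop test is false, so either the length is 1 or the decrease test
  has been passed.\<close>

lemma line_search_props:
  assumes input: "valid_input P Q" and ls: "line_search P Q w y d = Some l"
    and w: "w \<in> feasible" and wd: "w + d \<in> feasible" and d: "d \<noteq> 0"
  shows "1 \<le> l" and "w + l *\<^sub>R d \<in> feasible"
    and "l = 1 \<or> \<Phi>\<^sub>\<rho> P (w + l *\<^sub>R d) \<le> min (\<Phi>\<^sub>\<rho> P y) (\<Phi>\<^sub>\<rho> P w - sig Q * l\<^sup>2 * (norm d)\<^sup>2)"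
proof -
  have eta: "0 < eta Q" "eta Q < 1" "1 < lam_bar Q" using input by (auto simp: valid_input_def)
  have inv: "1 \<le> l \<and> l \<le> lam_max w d"
    using ls unfolding line_search_def
  proof (rule while_option_rule[rotated])
    show "1 \<le> min (lam_bar Q) (lam_max w d) \<and> min (lam_bar Q) (lam_max w d) \<le> lam_max w d"
      using lam_max_props(1)[OF w wd d] eta by simp
    show "1 \<le> max 1 (eta Q * s) \<and> max 1 (eta Q * s) \<le> lam_max w d"
      if s: "1 \<le> s \<and> s \<le> lam_max w d" for s
    proof -
      have "eta Q * s \<le> s" using s eta by (intro mult_left_le_one_le) auto
      then have "eta Q * s \<le> lam_max w d" using s by linarith
      then show ?thesis using s by simp
    qed
  qed
  then show "1 \<le> l" by simp
  show "w + l *\<^sub>R d \<in> feasible" using inv lam_max_props(2)[OF w wd d] by simp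
  show "l = 1 \<or> \<Phi>\<^sub>\<rho> P (w + l *\<^sub>R d) \<le> min (\<Phi>\<^sub>\<rho> P y) (\<Phi>\<^sub>\<rho> P w - sig Q * l\<^sup>2 * (norm d)\<^sup>2)"
    using while_option_stop[OF ls[unfolded line_search_def]] inv by auto
qed

lemma extrapolate_props:
  assumes "x \<in> feasible"
  shows "extrapolate P Q x' x \<in> feasible" and "\<Phi>\<^sub>\<rho> P (extrapolate P Q x' x) \<le> \<Phi>\<^sub>\<rho> P x"
  using assms closest_point_in_set[OF compact_imp_closed[OF compact_feasible]]
  by (auto simp: extrapolate_def Let_def)

text \<open>Only the expected return can be negative, and vectors in the simplex have norm at most
  1.\<close>

lemma \<Phi>_bounded_below:
  fixes x :: "('n::finite, 't::{finite,linorder}) decision"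
  assumes valid: "valid_model P" and x: "x \<in> feasible"
  shows "- (\<Sum>t\<in>UNIV. norm (mean P t)) \<le> \<Phi>\<^sub>\<rho> P x"
proof -
  have "mean P t \<bullet> x $ t \<le> norm (mean P t)" for t
  proof -
    have "mean P t \<bullet> x $ t \<le> norm (mean P t) * norm (x $ t)" by (rule norm_cauchy_schwarz)
    also have "\<dots> \<le> norm (mean P t)"
      using x by (intro mult_left_le unit_simplex_norm_le_1) (auto simp: feasible_def)
    finally show ?thesis .
  qed
  then have "(\<Sum>t\<in>UNIV. mean P t \<bullet> x $ t) \<le> (\<Sum>t\<in>UNIV. norm (mean P t))" by (rule sum_mono)
  moreover have "0 \<le> lam1 P * ((\<Sum>i\<in>UNIV. cost P $ i * \<bar>x $ first_period $ i - wprev P $ i\<bar>)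
        + (\<Sum>t\<in>UNIV - {first_period}. \<Sum>i\<in>UNIV. cost P $ i * \<bar>x $ t $ i - x $ prev_period t $ i\<bar>))"
    "0 \<le> lam2 P * (\<Sum>t\<in>UNIV. (norm (x $ t))\<^sup>2)" "0 \<le> rho P * var_penalty P x"
    using valid by (auto simp: valid_model_def var_penalty_def pos_part_def
        intro!: mult_nonneg_nonneg add_nonneg_nonneg sum_nonneg)
  ultimately show ?thesis by (simp add: \<Phi>\<^sub>\<rho>_def obj_def)
qed

text \<open>A step of length 1 lands on \<open>y\<close>, where \<open>dc_step_descent\<close> with
  \<open>sig Q < lam2 P + nu Q\<close> gives the decrease; any longer step has passed the line
  search test, which contains both bounds.\<close>

lemma iteration_descent:
  assumes valid: "valid_model P" and input: "valid_input P Q"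
    and w: "w \<in> feasible" and step: "dc_step P Q w y"
    and run: "\<not> stops Q w (y - w)" and ls: "line_search P Q w y (y - w) = Some l"
  shows "w + l *\<^sub>R (y - w) \<in> feasible" and "1 \<le> l"
    and "\<Phi>\<^sub>\<rho> P (w + l *\<^sub>R (y - w)) \<le> \<Phi>\<^sub>\<rho> P w - sig Q * l\<^sup>2 * (norm (y - w))\<^sup>2"
    and "\<Phi>\<^sub>\<rho> P (w + l *\<^sub>R (y - w)) \<le> \<Phi>\<^sub>\<rho> P y" and "\<Phi>\<^sub>\<rho> P y \<le> \<Phi>\<^sub>\<rho> P w"
proof -
  have sig: "0 < sig Q" "sig Q \<le> lam2 P + nu Q" using input by (auto simp: valid_input_def)
  note y = dc_step_descent[OF valid step w]
  have wd: "w + (y - w) \<in> feasible" using y(1) by simp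
  have d: "y - w \<noteq> 0" using run by (auto simp: stops_def)
  note l = line_search_props[OF input ls w wd d]
  show "w + l *\<^sub>R (y - w) \<in> feasible" "1 \<le> l" by (fact l)+
  have "sig Q * (norm (y - w))\<^sup>2 \<le> (lam2 P + nu Q) * (norm (y - w))\<^sup>2"
    using sig by (intro mult_right_mono) auto
  then have *: "\<Phi>\<^sub>\<rho> P y \<le> \<Phi>\<^sub>\<rho> P w - sig Q * (norm (y - w))\<^sup>2" using y(2) by simp
  moreover have "0 \<le> sig Q * (norm (y - w))\<^sup>2" using sig by simp
  ultimately show "\<Phi>\<^sub>\<rho> P y \<le> \<Phi>\<^sub>\<rho> P w" by linarith
  show "\<Phi>\<^sub>\<rho> P (w + l *\<^sub>R (y - w)) \<le> \<Phi>\<^sub>\<rho> P y"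
    "\<Phi>\<^sub>\<rho> P (w + l *\<^sub>R (y - w)) \<le> \<Phi>\<^sub>\<rho> P w - sig Q * l\<^sup>2 * (norm (y - w))\<^sup>2"
    using l(3) * by auto
qed

text \<open>Telescoping bounds every partial sum by \<open>(a 0 - m) / c\<close>.\<close>

lemma summable_of_descent:
  fixes a e :: "nat \<Rightarrow> real"
  assumes "0 < c" and nonneg: "\<And>k. 0 \<le> e k" and descent: "\<And>k. a (Suc k) \<le> a k - c * e k"
    and lower: "\<And>k. m \<le> a k"
  shows "summable e"
proof (rule summableI_nonneg_bounded[OF nonneg])
  fix n
  have "c * (\<Sum>k<n. e k) \<le> a 0 - a n"
  proof (induction n)
    case (Suc n)
    then show ?case using descent[of n] by (simp add: distrib_left)
  qed simp
  then have "c * (\<Sum>k<n. e k) \<le> a 0 - m" using lower[of n] by simp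
  then show "(\<Sum>k<n. e k) \<le> (a 0 - m) / c" using \<open>0 < c\<close> by (simp add: field_simps)
qed

theorem proposition4p2:
  fixes P :: "('w, 'n::finite, 't::{finite,linorder}) model"
    and Q :: alg_input
    and x w y d :: "nat \<Rightarrow> ('n, 't) decision"
    and lam :: "nat \<Rightarrow> real"
  assumes "valid_model P"
    and "valid_input P Q"
    and "infinite_run P Q x w y d lam"
  shows "(\<forall>k. \<Phi>\<^sub>\<rho> P (x (Suc k)) \<le> \<Phi>\<^sub>\<rho> P (w k) - sig Q * (lam k)\<^sup>2 * (norm (d k))\<^sup>2 \<and>
              \<Phi>\<^sub>\<rho> P (w k) - sig Q * (lam k)\<^sup>2 * (norm (d k))\<^sup>2
                \<le> \<Phi>\<^sub>\<rho> P (x k) - sig Q * (lam k)\<^sup>2 * (norm (d k))\<^sup>2) \<and>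
         (\<forall>k. \<Phi>\<^sub>\<rho> P (w (Suc k)) \<le> \<Phi>\<^sub>\<rho> P (x (Suc k)) \<and>
              \<Phi>\<^sub>\<rho> P (x (Suc k)) \<le> \<Phi>\<^sub>\<rho> P (y k) \<and>
              \<Phi>\<^sub>\<rho> P (y k) \<le> \<Phi>\<^sub>\<rho> P (w k)) \<and>
         (\<forall>k. \<Phi>\<^sub>\<rho> P (w (Suc k)) \<le> \<Phi>\<^sub>\<rho> P (w k) - sig Q * (lam k)\<^sup>2 * (norm (d k))\<^sup>2) \<and>
         decseq (\<lambda>k. \<Phi>\<^sub>\<rho> P (x k)) \<and>
         decseq (\<lambda>k. \<Phi>\<^sub>\<rho> P (w k)) \<and>
         summable (\<lambda>k. (lam k)\<^sup>2 * (norm (d k))\<^sup>2) \<and>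
         summable (\<lambda>k. (norm (d k))\<^sup>2)"

proof -
  let ?x' = "\<lambda>k. if k = 0 then x 0 else x (k - 1)"
  have run: "w k = extrapolate P Q (?x' k) (x k)" "dc_step P Q (w k) (y k)" "d k = y k - w k"
    "\<not> stops Q (w k) (y k - w k)" "line_search P Q (w k) (y k) (y k - w k) = Some (lam k)"
    "x (Suc k) = w k + lam k *\<^sub>R (y k - w k)" and x0: "x 0 \<in> feasible" for k
    using assms(3) unfolding infinite_run_def by metis+
  \<comment> \<open>Feasibility comes first, because the one-step estimates assume
    \<open>w k\<close> feasible.\<close>
  have x: "x k \<in> feasible" for k
  proof (induction k)
    case (Suc k)
    then have "w k \<in> feasible" by (simp add: run(1) extrapolate_props)
    from iteration_descent(1)[OF assms(1,2) this run(2,4,5)] show ?case by (simp add: run(6))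
  qed (rule x0)
  then have w: "w k \<in> feasible" and wx: "\<Phi>\<^sub>\<rho> P (w k) \<le> \<Phi>\<^sub>\<rho> P (x k)" for k
    by (simp_all add: run(1) extrapolate_props)
  note it = iteration_descent[OF assms(1,2) w run(2,4,5), folded run(3,6)]
  have sig: "0 < sig Q" using assms(2) by (simp add: valid_input_def)
  then have nonneg: "0 \<le> sig Q * (lam k)\<^sup>2 * (norm (d k))\<^sup>2" for k by simp
  have descent: "\<Phi>\<^sub>\<rho> P (w (Suc k)) \<le> \<Phi>\<^sub>\<rho> P (w k) - sig Q * (lam k)\<^sup>2 * (norm (d k))\<^sup>2" for k
    using wx[of "Suc k"] it(3)[of k] by simp
  have dec_x: "\<Phi>\<^sub>\<rho> P (x (Suc k)) \<le> \<Phi>\<^sub>\<rho> P (x k)" for k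
    using wx[of k] it(3)[of k] nonneg[of k] by linarith
  have dec_w: "\<Phi>\<^sub>\<rho> P (w (Suc k)) \<le> \<Phi>\<^sub>\<rho> P (w k)" for k
    using descent[of k] nonneg[of k] by linarith
  \<comment> \<open>The telescoping runs along the values at \<open>w k\<close>, for which
    \<open>descent\<close> has the required form.\<close>
  have sum: "summable (\<lambda>k. (lam k)\<^sup>2 * (norm (d k))\<^sup>2)"
    using sig descent \<Phi>_bounded_below[OF assms(1) w]
    by (intro summable_of_descent[where a = "\<lambda>k. \<Phi>\<^sub>\<rho> P (w k)" and c = "sig Q"]) (auto simp: mult.assoc)
  \<comment> \<open>Accepted step lengths are at least 1, so the weighted series dominates.\<close>
  moreover have "summable (\<lambda>k. (norm (d k))\<^sup>2)"
  proof (rule summable_comparison_test'[OF sum])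
    fix k
    have "1 * (norm (d k))\<^sup>2 \<le> (lam k)\<^sup>2 * (norm (d k))\<^sup>2"
      using it(2)[of k] by (intro mult_right_mono) (auto simp: one_le_power)
    then show "norm ((norm (d k))\<^sup>2) \<le> (lam k)\<^sup>2 * (norm (d k))\<^sup>2" by simp
  qed
  ultimately show ?thesis
    using it wx descent dec_x dec_w by (auto simp: decseq_Suc_iff)
qed

end
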